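(* The space $\mathcal H$ is a reproducing kernel Hilbert space, with reproducing kernel $$\mathsf K(z,w)=\sum_{n=0}^{\infty}\frac{z^n\overline{w}^n}{\eta_n}=\mathsf E(z\overline w),\qquad z,w\in\mathbb C.$$ Moreover, for every fixed $z\in\mathbb C$, $\|\mathsf K_z\|_{\mathcal H}^2=\mathsf K(z,z)=\mathsf E(|z|^2)$, where $\mathsf K_z:=\mathsf K(\cdot,z)$.
   Context: $\mathcal H$ denotes the Hörmander-Fock space: the space of entire functions $g:\mathbb C\to\mathbb C$ with $\|g\|_{\mathcal H}^2:=\frac1\pi\int_{\mathbb C}\frac{|g(z)|^2}{(1+|z|^2)^2}e^{-|z|^2}\,d\lambda(z)<\infty$, where $d\lambda$ is Lebesgue measure on $\mathbb C\cong\mathbb R^2$, with inner product $\langle u,v\rangle_{\mathcal H}:=\frac1\pi\int_{\mathbb C}\frac{u(z)\overline{v(z)}}{(1+|z|^2)^2}e^{-|z|^2}\,d\lambda(z)$. For $n=0,1,2,\dots$, $\eta_n:=\int_0^{\infty}\frac{t^n}{(1+t)^2}e^{-t}\,dt$, and $\mathsf E(z):=\sum_{n=0}^\infty \frac{z^n}{\eta_n}$ for $z\in\mathbb C$. *)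

theory Defs
  imports "HOL-Analysis.Analysis"
begin

section \<open>Hilbert spaces of complex-valued functions\<close>

text \<open>The inner product is linear in the first and conjugate linear in the second argument.
  Nothing is assumed about \<open>ip\<close> outside of \<open>H\<close>.\<close>

locale function_inner_product_space =
  fixes H :: "('a \<Rightarrow> complex) set"
    and ip :: "('a \<Rightarrow> complex) \<Rightarrow> ('a \<Rightarrow> complex) \<Rightarrow> complex"
  assumes zero_mem: "(\<lambda>x. 0) \<in> H"
    and add_mem: "f \<in> H \<Longrightarrow> g \<in> H \<Longrightarrow> (\<lambda>x. f x + g x) \<in> H"
    and scale_mem: "f \<in> H \<Longrightarrow> (\<lambda>x. c * f x) \<in> H"
    and ip_add_left: "f \<in> H \<Longrightarrow> g \<in> H \<Longrightarrow> h \<in> H \<Longrightarrow> ip (\<lambda>x. f x + g x) h = ip f h + ip g h"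
    and ip_scale_left: "f \<in> H \<Longrightarrow> g \<in> H \<Longrightarrow> ip (\<lambda>x. c * f x) g = c * ip f g"
    and ip_commute: "f \<in> H \<Longrightarrow> g \<in> H \<Longrightarrow> ip g f = cnj (ip f g)"
    and ip_self_nonneg: "f \<in> H \<Longrightarrow> 0 \<le> Re (ip f f)"
    and ip_self_eq_0: "f \<in> H \<Longrightarrow> ip f f = 0 \<Longrightarrow> f = (\<lambda>x. 0)"
begin

definition ip_norm :: "('a \<Rightarrow> complex) \<Rightarrow> real"
  where "ip_norm f = sqrt (Re (ip f f))"

definition ip_dist :: "('a \<Rightarrow> complex) \<Rightarrow> ('a \<Rightarrow> complex) \<Rightarrow> real"
  where "ip_dist f g = ip_norm (\<lambda>x. f x - g x)"

lemma diff_mem: "f \<in> H \<Longrightarrow> g \<in> H \<Longrightarrow> (\<lambda>x. f x - g x) \<in> H"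
  using add_mem[OF _ scale_mem[of g "-1"], of f] by simp

lemma ip_add_right:
  assumes "f \<in> H" "g \<in> H" "h \<in> H"
  shows "ip h (\<lambda>x. f x + g x) = ip h f + ip h g"
  using assms ip_commute[of _ h] add_mem ip_add_left by simp

lemma ip_scale_right:
  assumes "f \<in> H" "g \<in> H"
  shows "ip f (\<lambda>x. c * g x) = cnj c * ip f g"
  using assms ip_commute[of _ f] scale_mem ip_scale_left by simp

lemma ip_diff_left:
  assumes "f \<in> H" "g \<in> H" "h \<in> H"
  shows "ip (\<lambda>x. f x - g x) h = ip f h - ip g h"
  using ip_add_left[OF assms(1) scale_mem[of g "-1"], of h] ip_scale_left[of g h "-1"] assms
  by simp

lemma Im_ip_self: "f \<in> H \<Longrightarrow> Im (ip f f) = 0"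
  using ip_commute[of f f] by (simp add: complex_eq_iff)

lemma ip_norm_eq_0_iff: "f \<in> H \<Longrightarrow> ip_norm f = 0 \<longleftrightarrow> f = (\<lambda>x. 0)"
  using ip_self_eq_0[of f] Im_ip_self[of f] ip_scale_left[of f f 0]
  by (auto simp: ip_norm_def complex_eq_iff)

lemma ip_norm_power2: "f \<in> H \<Longrightarrow> (ip_norm f)\<^sup>2 = Re (ip f f)"
  by (simp add: ip_norm_def ip_self_nonneg)

lemma ip_norm_nonneg: "f \<in> H \<Longrightarrow> 0 \<le> ip_norm f"
  by (simp add: ip_norm_def ip_self_nonneg)

lemma ip_norm_add_scale:
  assumes "f \<in> H" "g \<in> H"
  shows "(ip_norm (\<lambda>x. f x + of_real t * g x))\<^sup>2
    = (ip_norm f)\<^sup>2 + 2 * t * Re (ip f g) + t\<^sup>2 * (ip_norm g)\<^sup>2"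
  using assms ip_commute[of f g]
  by (simp add: ip_norm_power2 add_mem scale_mem ip_add_left ip_add_right ip_scale_left
      ip_scale_right algebra_simps power2_eq_square[of t])

lemma Re_ip_le:
  assumes "f \<in> H" "g \<in> H"
  shows "Re (ip f g) \<le> ip_norm f * ip_norm g"
proof (cases "ip_norm g = 0")
  case True
  then have "ip f g = 0"
    using assms ip_norm_eq_0_iff ip_scale_right[of f g 0] by simp
  then show ?thesis using True by simp
next
  case False
  define b where "b = Re (ip f g)"
  define a where "a = ip_norm f"
  define c where "c = ip_norm g"
  have c: "c \<noteq> 0" using False by (simp add: c_def)
  have "0 \<le> (ip_norm (\<lambda>x. f x + of_real (- (b / c\<^sup>2)) * g x))\<^sup>2" by simp
  also have "\<dots> = a\<^sup>2 - 2 * (b / c\<^sup>2) * b + (b / c\<^sup>2)\<^sup>2 * c\<^sup>2"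
    using ip_norm_add_scale[OF assms, of "- (b / c\<^sup>2)"] by (simp add: a_def b_def c_def)
  also have "\<dots> = a\<^sup>2 - b\<^sup>2 / c\<^sup>2"
    using c by (simp add: power2_eq_square field_simps)
  finally have "b\<^sup>2 \<le> (a * c)\<^sup>2"
    using c by (simp add: field_simps power_mult_distrib)
  moreover have "0 \<le> a * c" using assms by (simp add: a_def c_def ip_norm_nonneg)
  ultimately have "b \<le> a * c" by (rule power2_le_imp_le)
  then show ?thesis by (simp add: a_def b_def c_def)
qed

lemma ip_norm_triangle:
  assumes "f \<in> H" "g \<in> H"
  shows "ip_norm (\<lambda>x. f x + g x) \<le> ip_norm f + ip_norm g"
proof (rule power2_le_imp_le)
  show "(ip_norm (\<lambda>x. f x + g x))\<^sup>2 \<le> (ip_norm f + ip_norm g)\<^sup>2"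
    using ip_norm_add_scale[OF assms, of 1] Re_ip_le[OF assms]
    by (simp add: power2_sum)
  show "0 \<le> ip_norm f + ip_norm g" using assms by (simp add: ip_norm_nonneg)
qed

lemma ip_norm_minus: "f \<in> H \<Longrightarrow> ip_norm (\<lambda>x. - f x) = ip_norm f"
  using ip_scale_left[OF _ scale_mem, of f f "-1" "-1"] ip_scale_right[of f f "-1"]
  by (simp add: ip_norm_def)

end

text \<open>\<^const>\<open>Metric_space\<close> constrains the distance on all of the type, not just on the carrier,
  hence the case distinction.\<close>

definition restrict_dist :: "'b set \<Rightarrow> ('b \<Rightarrow> 'b \<Rightarrow> real) \<Rightarrow> 'b \<Rightarrow> 'b \<Rightarrow> real"
  where "restrict_dist M d x y = (if x \<in> M \<and> y \<in> M then d x y else 0)"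

lemma (in function_inner_product_space) Metric_space_ip:
  "Metric_space H (restrict_dist H ip_dist)"
proof
  fix f g :: "'a \<Rightarrow> complex"
  show "0 \<le> restrict_dist H ip_dist f g"
    by (simp add: restrict_dist_def ip_dist_def ip_norm_nonneg diff_mem)
  show "restrict_dist H ip_dist f g = restrict_dist H ip_dist g f"
    using ip_norm_minus[OF diff_mem, of f g] by (auto simp: restrict_dist_def ip_dist_def)
next
  fix f g assume "f \<in> H" "g \<in> H"
  then show "restrict_dist H ip_dist f g = 0 \<longleftrightarrow> f = g"
    by (auto simp: restrict_dist_def ip_dist_def ip_norm_eq_0_iff diff_mem fun_eq_iff)
next
  fix f g h assume "f \<in> H" "g \<in> H" "h \<in> H"
  then show "restrict_dist H ip_dist f h \<le> restrict_dist H ip_dist f g + restrict_dist H ip_dist g h"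
    using ip_norm_triangle[OF diff_mem diff_mem, of f g g h]
    by (simp add: restrict_dist_def ip_dist_def)
qed

locale function_hilbert_space = function_inner_product_space +
  assumes complete: "Metric_space.mcomplete H (restrict_dist H ip_dist)"

text \<open>Point evaluations are bounded linear functionals.\<close>

locale reproducing_kernel_hilbert_space = function_hilbert_space +
  assumes bounded_eval: "\<exists>C. \<forall>f\<in>H. cmod (f x) \<le> C * ip_norm f"

definition is_reproducing_kernel ::
    "('a \<Rightarrow> complex) set \<Rightarrow> (('a \<Rightarrow> complex) \<Rightarrow> ('a \<Rightarrow> complex) \<Rightarrow> complex)
      \<Rightarrow> ('a \<Rightarrow> 'a \<Rightarrow> complex) \<Rightarrow> bool"
  where "is_reproducing_kernel H ip K \<longleftrightarrow>
    (\<forall>w. (\<lambda>z. K z w) \<in> H \<and> (\<forall>f\<in>H. f w = ip f (\<lambda>z. K z w)))"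

lemma (in function_inner_product_space) reproducing_kernel_unique:
  assumes "is_reproducing_kernel H ip K" "is_reproducing_kernel H ip L"
  shows "K = L"
proof (intro ext)
  fix z w
  have K: "(\<lambda>z. K z w) \<in> H" and L: "(\<lambda>z. L z w) \<in> H"
    using assms by (auto simp: is_reproducing_kernel_def)
  let ?d = "\<lambda>z. K z w - L z w"
  have d: "?d \<in> H" using K L by (rule diff_mem)
  have "ip ?d (\<lambda>z. K z w) = ?d w" "ip ?d (\<lambda>z. L z w) = ?d w"
    using assms bspec[OF _ d, of "\<lambda>f. f w = ip f (\<lambda>z. K z w)"]
      bspec[OF _ d, of "\<lambda>f. f w = ip f (\<lambda>z. L z w)"]
    by (auto simp: is_reproducing_kernel_def)
  then have "ip ?d (\<lambda>z. K z w) = ip ?d (\<lambda>z. L z w)" by simp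
  then have "ip (\<lambda>z. K z w) ?d = ip (\<lambda>z. L z w) ?d"
    using ip_commute[OF d K] ip_commute[OF d L] by simp
  then have "ip ?d ?d = 0" using ip_diff_left[OF K L d] by simp
  then show "K z w = L z w" using ip_self_eq_0[OF d] by (simp add: fun_eq_iff)
qed


section \<open>The Hoermander-Fock space\<close>

definition HF_space :: "(complex \<Rightarrow> complex) set"
  where "HF_space = {g. g holomorphic_on UNIV \<and>
    integrable lborel (\<lambda>z. (cmod (g z))\<^sup>2 / (1 + (cmod z)\<^sup>2)\<^sup>2 * exp (- (cmod z)\<^sup>2))}"

definition HF_norm :: "(complex \<Rightarrow> complex) \<Rightarrow> real"
  where "HF_norm g =
    sqrt (1 / pi * (\<integral>z. (cmod (g z))\<^sup>2 / (1 + (cmod z)\<^sup>2)\<^sup>2 * exp (- (cmod z)\<^sup>2) \<partial>lborel))"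

definition HF_inner :: "(complex \<Rightarrow> complex) \<Rightarrow> (complex \<Rightarrow> complex) \<Rightarrow> complex"
  where "HF_inner u v = of_real (1 / pi) *
    (\<integral>z. u z * cnj (v z) / of_real ((1 + (cmod z)\<^sup>2)\<^sup>2) * of_real (exp (- (cmod z)\<^sup>2)) \<partial>lborel)"

lemma HF_inner_self: "HF_inner g g = of_real ((HF_norm g)\<^sup>2)"
proof -
  let ?f = "\<lambda>z. (cmod (g z))\<^sup>2 / (1 + (cmod z)\<^sup>2)\<^sup>2 * exp (- (cmod z)\<^sup>2)"
  have "(HF_norm g)\<^sup>2 = 1 / pi * (\<integral>z. ?f z \<partial>lborel)"
    unfolding HF_norm_def by (intro real_sqrt_pow2 mult_nonneg_nonneg integral_nonneg_AE) auto
  moreover have "HF_inner g g = of_real (1 / pi) * (\<integral>z. of_real (?f z) \<partial>lborel)"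
    unfolding HF_inner_def by (simp add: complex_norm_square[symmetric])
  ultimately show ?thesis by (simp only: integral_complex_of_real of_real_mult[of "1 / pi"])
qed

definition HF_eta :: "nat \<Rightarrow> real"
  where "HF_eta n = (LINT t:{0..}|lborel. t ^ n / (1 + t)\<^sup>2 * exp (- t))"

definition HF_E :: "complex \<Rightarrow> complex"
  where "HF_E z = (\<Sum>n. z ^ n / of_real (HF_eta n))"

definition HF_kernel :: "complex \<Rightarrow> complex \<Rightarrow> complex"
  where "HF_kernel z w = (\<Sum>n. z ^ n * cnj w ^ n / of_real (HF_eta n))"

end

theory Submission
  imports Defs "HOL-Complex_Analysis.Cauchy_Integral_Formula"
begin

text \<open>
  The weight is radial, so rotation invariance makes the monomials orthogonal, and the substitution
  \<open>t = |z|\<^sup>2\<close>, under which the plane Lebesgue measure becomes \<open>\<pi>\<close> times the measure on the half line,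
  gives \<open>\<parallel>z\<^sup>n\<parallel>\<^sup>2 = \<eta>\<^sub>n\<close>. The moments \<open>\<eta>\<^sub>n\<close> grow faster than any geometric sequence, hence the kernel
  series converges everywhere, and by Fatou's lemma it also converges in norm. For \<open>f = \<Sum> a\<^sub>n z\<^sup>n\<close>
  in the space, integration over discs gives \<open>\<langle>f, z\<^sup>n\<rangle> = a\<^sub>n \<eta>\<^sub>n\<close>; pairing \<open>f\<close> with the partial sums of
  the kernel and passing to the limit yields the reproducing property. By Cauchy-Schwarz, point evaluations are then
  bounded uniformly on discs, so a Cauchy sequence converges locally uniformly to an
  entire function, which is its norm limit by Fatou's lemma again.
\<close>

section \<open>Rotations and the radial part of the Lebesgue measure\<close>

lemma emeasure_lborel_isometry_vimage:
  fixes U :: "real^'n::{finite,wellorder} \<Rightarrow> real^'n::_"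
  assumes U: "orthogonal_transformation U" and B: "open B" "bounded B"
  shows "emeasure lborel (U -` B) = emeasure lborel B"
proof -
  have lin: "linear U" using U by (rule orthogonal_transformation_linear)
  have "open (U -` B)"
    using B(1) lin by (simp add: open_vimage linear_continuous_on linear_linear)
  moreover obtain C where C: "\<And>x. x \<in> B \<Longrightarrow> norm x \<le> C"
    using B(2) by (auto simp: bounded_iff)
  have "bounded (U -` B)"
    unfolding bounded_iff
    using C U by (intro exI[of _ C] ballI) (metis orthogonal_transformation vimageD)
  ultimately have L: "U -` B \<in> lmeasurable" by (simp add: lmeasurable_open)
  have "U ` (U -` B) = B"
    using orthogonal_transformation_surj[OF U] by (rule surj_image_vimage_eq)
  then have "measure lebesgue B = measure lebesgue (U -` B)"
    using measure_orthogonal_image[OF U L] by simp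
  then have "emeasure lebesgue B = emeasure lebesgue (U -` B)"
    using L B by (simp add: emeasure_eq_measure2 lmeasurable_open)
  then show ?thesis using B(1) \<open>open (U -` B)\<close> by (simp add: borel_open)
qed

text \<open>The library knows that orthogonal maps preserve measure only on \<open>real^'n\<close>, so rotations of
  the complex plane are transported to \<open>real^2\<close>.\<close>

lemma distr_lborel_isometry:
  fixes T :: "real^2 \<Rightarrow> complex"
  assumes lin: "linear T" and norm: "\<And>v. cmod (T v) = norm v"
  shows "distr lborel borel T = lborel"
proof (rule lborel_eqI[symmetric])
  have meas: "T \<in> borel_measurable borel"
    using lin by (intro borel_measurable_continuous_onI linear_continuous_on) (simp add: linear_linear)
  fix l u :: complex
  assume le: "\<And>b. b \<in> Basis \<Longrightarrow> l \<bullet> b \<le> u \<bullet> b"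
  \<comment> \<open>\<open>J\<close> reads off coordinates, so \<open>J \<circ> T\<close> is an
    orthogonal map of the plane \<open>real^2\<close> to itself, and the preimage of a complex box
    under \<open>T\<close> is the preimage of a coordinate box under
    \<open>J \<circ> T\<close>.\<close>
  define J :: "complex \<Rightarrow> real^2" where "J z = vector [Re z, Im z]" for z
  have "orthogonal_transformation (J \<circ> T)"
    unfolding orthogonal_transformation
  proof (intro conjI allI linear_compose lin)
    show "linear J" by (rule linearI) (auto simp: J_def vec_eq_iff forall_2 vector_2)
    show "norm ((J \<circ> T) v) = norm v" for v
      unfolding norm[symmetric, of v]
      by (simp add: J_def norm_vec_def L2_set_def sum_2 cmod_def)
  qed
  moreover have "T -` box l u = (J \<circ> T) -` box (J l) (J u)"
    by (auto simp: box_vec_eq_empty mem_box_cart J_def forall_2 in_box_complex_iff)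
  ultimately have "emeasure lborel (T -` box l u) = emeasure lborel (box (J l) (J u))"
    using emeasure_lborel_isometry_vimage[OF _ open_box bounded_box] by metis
  also have "\<dots> = (\<Prod>b\<in>Basis. (J u - J l) \<bullet> b)"
  proof (rule emeasure_lborel_box)
    have "\<forall>i. J l $ i \<le> J u $ i"
      using le[of 1] le[of \<i>] by (simp add: J_def forall_2 Basis_complex_def)
    then show "J l \<bullet> b \<le> J u \<bullet> b" if "b \<in> Basis" for b
      using that by (auto simp: Basis_vec_def inner_axis)
  qed
  also have "(\<Prod>b\<in>Basis. (J u - J l) \<bullet> b) = (\<Prod>b\<in>Basis. (u - l) \<bullet> b)"
  proof -
    have B: "(Basis :: (real^2) set) = {axis 1 1, axis 2 1}"
      by (auto simp: Basis_vec_def) (metis exhaust_2)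
    have "axis (1::2) (1::real) \<noteq> axis 2 1" by (simp add: axis_eq_axis)
    then show ?thesis unfolding B by (simp add: J_def inner_axis Basis_complex_def)
  qed
  finally show "emeasure (distr lborel borel T) (box l u) = (\<Prod>b\<in>Basis. (u - l) \<bullet> b)"
    using meas by (simp add: emeasure_distr)
qed simp

text \<open>The coordinate map \<open>T\<close> and its rotated version \<open>c * T v\<close> are
  both linear isometries from \<open>real^2\<close>, so both push \<open>lborel\<close> forward to
  \<open>lborel\<close>. Comparing the two leaves the rotation alone.\<close>

lemma distr_lborel_rotation:
  fixes c :: complex
  assumes c: "cmod c = 1"
  shows "distr lborel borel ((*) c) = lborel"
proof -
  define T :: "real^2 \<Rightarrow> complex" where "T v = Complex (v $ 1) (v $ 2)" for v
  have lin: "linear T" by (rule linearI) (auto simp: T_def complex_eq_iff)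
  have norm: "cmod (T v) = norm v" for v
    by (simp add: T_def norm_vec_def L2_set_def sum_2 cmod_def)
  have lin': "linear (\<lambda>v. c * T v)"
    using linear_compose[OF lin bounded_linear.linear[OF bounded_linear_mult_right[of c]]]
    by (simp add: o_def)
  have T: "T \<in> borel_measurable borel"
    using lin by (intro borel_measurable_continuous_onI linear_continuous_on) (simp add: linear_linear)
  have "distr lborel borel ((*) c) = distr (distr lborel borel T) borel ((*) c)"
    using distr_lborel_isometry[OF lin norm] by simp
  also have "\<dots> = distr lborel borel (\<lambda>v. c * T v)"
    by (subst distr_distr) (auto simp: o_def T)
  also have "\<dots> = lborel"
    by (rule distr_lborel_isometry) (auto simp: lin' norm norm_mult c)
  finally show ?thesis .
qed

text \<open>The half lines \<open>{..a}\<close> form an intersection-stable generator of the Borel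
  sets. For nonnegative \<open>a\<close> the preimage of \<open>{..a}\<close> is the disc of radius
  \<open>sqrt a\<close>, whose area is linear in \<open>a\<close>.\<close>

lemma distr_lborel_norm_square:
  "distr lborel borel (\<lambda>z::complex. (cmod z)\<^sup>2) = density lborel (\<lambda>t. ennreal pi * indicator {0..} t)"
proof (rule measure_eqI_generator_eq[where E="range atMost" and \<Omega>=UNIV and A="\<lambda>n::nat. {..real n}"])
  show "Int_stable (range (atMost :: real \<Rightarrow> real set))"
    by (auto simp: Int_stable_def Int_atMost)
  have *: "emeasure (distr lborel borel (\<lambda>z::complex. (cmod z)\<^sup>2)) {..a} =
      (if a < 0 then 0 else ennreal (pi * a))" for a :: real
  proof (cases "a < 0")
    case True
    then have "\<not> (cmod z)\<^sup>2 \<le> a" for z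
      using zero_le_power2[of "cmod z"] by linarith
    then have "(\<lambda>z::complex. (cmod z)\<^sup>2) -` {..a} = {}" by auto
    then show ?thesis using True by (simp add: emeasure_distr)
  next
    case False
    have "(cmod z)\<^sup>2 \<le> a \<longleftrightarrow> cmod z \<le> sqrt a" for z
      using real_sqrt_le_iff[of "(cmod z)\<^sup>2" a] by simp
    then have "(\<lambda>z::complex. (cmod z)\<^sup>2) -` {..a} = cball 0 (sqrt a)" by auto
    then show ?thesis using False
      by (simp add: emeasure_distr emeasure_cball unit_ball_vol_2)
  qed
  fix X :: "real set" assume "X \<in> range atMost"
  then obtain a where X: "X = {..a}" by auto
  have "emeasure (density lborel (\<lambda>t. ennreal pi * indicator {0..} t)) {..a}
      = (\<integral>\<^sup>+t. ennreal pi * indicator {0..a} t \<partial>lborel)"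
    by (subst emeasure_density) (auto intro!: nn_integral_cong split: split_indicator)
  also have "\<dots> = ennreal pi * emeasure lborel {0..a}"
    by (subst nn_integral_cmult_indicator) auto
  also have "\<dots> = (if a < 0 then 0 else ennreal (pi * a))"
    by (auto simp: ennreal_mult)
  finally show "emeasure (distr lborel borel (\<lambda>z::complex. (cmod z)\<^sup>2)) X
      = emeasure (density lborel (\<lambda>t. ennreal pi * indicator {0..} t)) X"
    unfolding X * by simp
next
  \<comment> \<open>The half lines exhausting the real line have finite measure, as uniqueness of
    measures requires.\<close>
  fix n :: nat
  have "(\<lambda>z::complex. (cmod z)\<^sup>2) -` {..real n} \<subseteq> cball 0 (sqrt n)"
    by (auto simp: real_le_rsqrt)
  then have "emeasure lborel ((\<lambda>z::complex. (cmod z)\<^sup>2) -` {..real n}) \<le> emeasure lborel (cball (0::complex) (sqrt n))"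
    by (intro emeasure_mono) auto
  also have "\<dots> < \<infinity>" by (simp add: emeasure_cball)
  finally show "emeasure (distr lborel borel (\<lambda>z::complex. (cmod z)\<^sup>2)) {..real n} \<noteq> \<infinity>"
    by (simp add: emeasure_distr)
qed (auto simp: borel_eq_atMost intro: real_arch_simple)

lemma nn_integral_lborel_norm_square:
  assumes [measurable]: "h \<in> borel_measurable borel"
  shows "(\<integral>\<^sup>+z. h ((cmod z)\<^sup>2) \<partial>lborel) = ennreal pi * (\<integral>\<^sup>+t. h t * indicator {0..} t \<partial>lborel)"
proof -
  have "(\<integral>\<^sup>+z. h ((cmod z)\<^sup>2) \<partial>lborel) = (\<integral>\<^sup>+t. h t \<partial>distr lborel borel (\<lambda>z::complex. (cmod z)\<^sup>2))"
    by (rule nn_integral_distr[symmetric]) auto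
  also have "\<dots> = (\<integral>\<^sup>+t. ennreal pi * (h t * indicator {0..} t) \<partial>lborel)"
    unfolding distr_lborel_norm_square by (subst nn_integral_density) (auto simp: ac_simps)
  finally show ?thesis by (simp add: nn_integral_cmult)
qed

section \<open>Moments of the weight\<close>

lemma borel_measurable_cnj [measurable (raw)]:
  "f \<in> borel_measurable M \<Longrightarrow> (\<lambda>x. cnj (f x)) \<in> borel_measurable M"
  by (rule measurable_compose[OF _ borel_measurable_continuous_onI])
    (auto intro: continuous_on_cnj continuous_on_id)

lemma integrable_mult_cnj:
  fixes f g :: "'a \<Rightarrow> complex"
  assumes [measurable]: "f \<in> borel_measurable M" "g \<in> borel_measurable M"
    and "integrable M (\<lambda>x. (cmod (f x))\<^sup>2)" "integrable M (\<lambda>x. (cmod (g x))\<^sup>2)"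
  shows "integrable M (\<lambda>x. f x * cnj (g x))"
proof (rule Bochner_Integration.integrable_bound)
  show "integrable M (\<lambda>x. (cmod (f x))\<^sup>2 + (cmod (g x))\<^sup>2)" using assms by simp
  have "cmod (f x) * cmod (g x) \<le> (cmod (f x))\<^sup>2 + (cmod (g x))\<^sup>2" for x
    using sum_squares_bound[of "cmod (f x)" "cmod (g x)"]
      mult_nonneg_nonneg[OF norm_ge_zero norm_ge_zero, of "f x" "g x"] by linarith
  then show "AE x in M. norm (f x * cnj (g x)) \<le> norm ((cmod (f x))\<^sup>2 + (cmod (g x))\<^sup>2)"
    by (simp add: norm_mult)
qed measurable

lemma integrable_norm_square_add:
  fixes f g :: "'a \<Rightarrow> complex"
  assumes [measurable]: "f \<in> borel_measurable M" "g \<in> borel_measurable M"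
    and "integrable M (\<lambda>x. (cmod (f x))\<^sup>2)" "integrable M (\<lambda>x. (cmod (g x))\<^sup>2)"
  shows "integrable M (\<lambda>x. (cmod (f x + g x))\<^sup>2)"
proof (rule Bochner_Integration.integrable_bound)
  show "integrable M (\<lambda>x. 2 * (cmod (f x))\<^sup>2 + 2 * (cmod (g x))\<^sup>2)" using assms by simp
  have "(cmod (f x + g x))\<^sup>2 \<le> 2 * (cmod (f x))\<^sup>2 + 2 * (cmod (g x))\<^sup>2" for x
  proof -
    have "(cmod (f x + g x))\<^sup>2 \<le> (cmod (f x) + cmod (g x))\<^sup>2"
      by (intro power_mono norm_triangle_ineq) auto
    also have "\<dots> \<le> 2 * (cmod (f x))\<^sup>2 + 2 * (cmod (g x))\<^sup>2"
      using sum_squares_bound[of "cmod (f x)" "cmod (g x)"] by (simp add: power2_sum)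
    finally show ?thesis .
  qed
  then show "AE x in M. norm ((cmod (f x + g x))\<^sup>2) \<le> norm (2 * (cmod (f x))\<^sup>2 + 2 * (cmod (g x))\<^sup>2)"
    by (simp add: abs_of_nonneg)
qed measurable

text \<open>The factor \<open>1 / pi\<close> is absorbed into the density, so that
  \<open>HF_inner\<close> becomes the plain L2 inner product of this measure.\<close>

definition HF_measure :: "complex measure"
  where "HF_measure =
    density lborel (\<lambda>z. ennreal (exp (- (cmod z)\<^sup>2) / (pi * (1 + (cmod z)\<^sup>2)\<^sup>2)))"

lemma sets_HF_measure [simp, measurable_cong]: "sets HF_measure = sets borel"
  by (simp add: HF_measure_def)

lemma space_HF_measure [simp]: "space HF_measure = UNIV"
  by (simp add: HF_measure_def)

lemma borel_measurable_HF_measure [simp]: "borel_measurable HF_measure = borel_measurable borel"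
  by (simp add: measurable_def)

lemma borel_measurable_entire: "f holomorphic_on UNIV \<Longrightarrow> f \<in> borel_measurable borel"
  by (intro borel_measurable_continuous_onI holomorphic_on_imp_continuous_on)

lemma HF_space_iff:
  "g \<in> HF_space \<longleftrightarrow> g holomorphic_on UNIV \<and> integrable HF_measure (\<lambda>z. (cmod (g z))\<^sup>2)"
proof -
  have "integrable HF_measure (\<lambda>z. (cmod (g z))\<^sup>2) \<longleftrightarrow>
      integrable lborel (\<lambda>z. (cmod (g z))\<^sup>2 / (1 + (cmod z)\<^sup>2)\<^sup>2 * exp (- (cmod z)\<^sup>2))"
    if "g holomorphic_on UNIV"
  proof -
    have [measurable]: "g \<in> borel_measurable borel" using that by (rule borel_measurable_entire)
    let ?F = "\<lambda>z. (cmod (g z))\<^sup>2 / (1 + (cmod z)\<^sup>2)\<^sup>2 * exp (- (cmod z)\<^sup>2)"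
    have "integrable HF_measure (\<lambda>z. (cmod (g z))\<^sup>2) \<longleftrightarrow>
      integrable lborel (\<lambda>z. 1 / pi * ((cmod (g z))\<^sup>2 / (1 + (cmod z)\<^sup>2)\<^sup>2 * exp (- (cmod z)\<^sup>2)))"
      unfolding HF_measure_def by (subst integrable_density) (auto simp: field_simps)
    moreover have "integrable lborel (\<lambda>z. 1 / pi * ?F z) \<longleftrightarrow> integrable lborel ?F"
      by (rule trans[OF integrable_mult_left_iff]) simp
    ultimately show ?thesis by simp
  qed
  then show ?thesis by (auto simp: HF_space_def)
qed

lemma HF_inner_eq:
  assumes [measurable]: "u \<in> borel_measurable borel" "v \<in> borel_measurable borel"
  shows "HF_inner u v = (\<integral>z. u z * cnj (v z) \<partial>HF_measure)"
proof -
  have "(\<integral>z. u z * cnj (v z) \<partial>HF_measure) = (\<integral>z. of_real (1 / pi) *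
      (u z * cnj (v z) / of_real ((1 + (cmod z)\<^sup>2)\<^sup>2) * of_real (exp (- (cmod z)\<^sup>2))) \<partial>lborel)"
    unfolding HF_measure_def
    by (subst integral_density) (auto simp: scaleR_conv_of_real intro!: Bochner_Integration.integral_cong)
  then show ?thesis unfolding HF_inner_def by (simp only: integral_mult_right_zero)
qed

text \<open>The \<open>pi\<close> produced by the substitution of the squared modulus cancels the
  \<open>pi\<close> in the density.\<close>

lemma nn_integral_HF_measure_radial:
  assumes [measurable]: "h \<in> borel_measurable borel"
  shows "(\<integral>\<^sup>+z. h ((cmod z)\<^sup>2) \<partial>HF_measure)
    = (\<integral>\<^sup>+t. ennreal (exp (- t) / (1 + t)\<^sup>2) * h t * indicator {0..} t \<partial>lborel)"
proof -
  have "(\<integral>\<^sup>+z. h ((cmod z)\<^sup>2) \<partial>HF_measure) =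
      (\<integral>\<^sup>+z. (\<lambda>t. ennreal (exp (- t) / (pi * (1 + t)\<^sup>2)) * h t) ((cmod z)\<^sup>2) \<partial>lborel)"
    unfolding HF_measure_def by (subst nn_integral_density) auto
  also have "\<dots> = ennreal pi * (\<integral>\<^sup>+t. ennreal (exp (- t) / (pi * (1 + t)\<^sup>2)) * h t * indicator {0..} t \<partial>lborel)"
    by (rule nn_integral_lborel_norm_square) measurable
  also have "\<dots> = (\<integral>\<^sup>+t. ennreal pi * (ennreal (exp (- t) / (pi * (1 + t)\<^sup>2)) * h t * indicator {0..} t) \<partial>lborel)"
    by (rule nn_integral_cmult[symmetric]) measurable
  also have "\<dots> = (\<integral>\<^sup>+t. ennreal (exp (- t) / (1 + t)\<^sup>2) * h t * indicator {0..} t \<partial>lborel)"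
  proof (rule nn_integral_cong)
    fix t :: real
    have "ennreal pi * ennreal (exp (- t) / (pi * (1 + t)\<^sup>2)) = ennreal (exp (- t) / (1 + t)\<^sup>2)"
      by (subst ennreal_mult[symmetric]) auto
    then show "ennreal pi * (ennreal (exp (- t) / (pi * (1 + t)\<^sup>2)) * h t * indicator {0..} t)
      = ennreal (exp (- t) / (1 + t)\<^sup>2) * h t * indicator {0..} t"
      by (simp flip: mult.assoc)
  qed
  finally show ?thesis .
qed

section \<open>The moments and their growth\<close>

lemma set_integrable_HF_eta: "set_integrable lborel {0..} (\<lambda>t::real. t ^ n / (1 + t)\<^sup>2 * exp (- t))"
  unfolding set_integrable_def
proof (rule integrableI_bounded)
  \<comment> \<open>Since the denominator is at least 1, dropping it leaves the Gamma integral at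
    \<open>n + 1\<close>.\<close>
  have "(\<integral>\<^sup>+t. norm (indicat_real {0..} (t::real) *\<^sub>R (t ^ n / (1 + t)\<^sup>2 * exp (- t))) \<partial>lborel)
    \<le> (\<integral>\<^sup>+t. ennreal (indicator {0..} (t::real) * t powr (real (Suc n) - 1) / exp t) \<partial>lborel)"
  proof (rule nn_integral_mono_AE)
    \<comment> \<open>The origin is removed because \<open>0 powr 0\<close> is 0 whereas
      \<open>0 ^ 0\<close> is 1, so the pointwise bound fails there for
      \<open>n = 0\<close>.\<close>
    have "AE t in lborel. (t::real) \<noteq> 0" by (rule AE_lborel_singleton)
    then show "AE t in lborel. ennreal (norm (indicat_real {0..} t *\<^sub>R (t ^ n / (1 + t)\<^sup>2 * exp (- t))))
      \<le> ennreal (indicator {0..} t * t powr (real (Suc n) - 1) / exp t)"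
    proof eventually_elim
      case (elim t)
      show ?case
      proof (cases "t > 0")
        case True
        have "t ^ n / (1 + t)\<^sup>2 \<le> t ^ n / 1"
          using True by (intro divide_left_mono one_le_power) auto
        then have "t ^ n / (1 + t)\<^sup>2 * exp (- t) \<le> t ^ n * exp (- t)"
          by (intro mult_right_mono) auto
        then show ?thesis using True
          by (intro ennreal_leI) (simp add: powr_realpow exp_minus divide_inverse)
      qed (use elim in auto)
    qed
  qed
  also have "\<dots> = ennreal (Gamma (real (Suc n)))"
    by (rule Gamma_conv_nn_integral_real[symmetric]) simp
  also have "\<dots> < \<infinity>" by simp
  finally show "(\<integral>\<^sup>+t. norm (indicat_real {0..} (t::real) *\<^sub>R (t ^ n / (1 + t)\<^sup>2 * exp (- t))) \<partial>lborel) < \<infinity>" .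
qed measurable

text \<open>Only the interval from \<open>A\<close> to \<open>A + 1\<close> is kept, and each factor
  of the integrand is replaced by its minimum there. As \<open>A\<close> is arbitrary and the second
  factor does not depend on \<open>n\<close>, the moments outgrow every geometric sequence.\<close>

lemma HF_eta_ge:
  assumes A: "A \<ge> 0"
  shows "A ^ n * (exp (- (A + 1)) / (2 + A)\<^sup>2) \<le> HF_eta n"
proof -
  let ?c = "A ^ n * (exp (- (A + 1)) / (2 + A)\<^sup>2)"
  have "?c = (LINT t|lborel. indicator {A..A+1} t *\<^sub>R ?c)" by simp
  also have "\<dots> \<le> HF_eta n"
    unfolding HF_eta_def set_lebesgue_integral_def
  proof (rule integral_mono)
    show "integrable lborel (\<lambda>t::real. indicat_real {0..} t *\<^sub>R (t ^ n / (1 + t)\<^sup>2 * exp (- t)))"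
      by (rule set_integrable_HF_eta[unfolded set_integrable_def])
    fix t :: real
    show "indicat_real {A..A + 1} t *\<^sub>R ?c \<le> indicat_real {0..} t *\<^sub>R (t ^ n / (1 + t)\<^sup>2 * exp (- t))"
    proof (cases "t \<in> {A..A+1}")
      case True
      then have "A ^ n \<le> t ^ n" "1 / (2 + A)\<^sup>2 \<le> 1 / (1 + t)\<^sup>2" "exp (- (A + 1)) \<le> exp (- t)"
        using A by (auto intro!: power_mono divide_left_mono)
      then have "A ^ n * (1 / (2 + A)\<^sup>2) * exp (- (A + 1)) \<le> t ^ n * (1 / (1 + t)\<^sup>2) * exp (- t)"
        using A True by (intro mult_mono) auto
      then show ?thesis using A True by simp
    qed (use A in \<open>auto split: split_indicator\<close>)
  qed simp
  finally show ?thesis .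
qed

lemma HF_eta_pos: "HF_eta n > 0"
  by (rule less_le_trans[OF _ HF_eta_ge[of 1 n]]) simp_all

lemma summable_HF_eta:
  assumes x: "x \<ge> 0"
  shows "summable (\<lambda>n. x ^ n / HF_eta n)"
proof (rule summable_comparison_test')
  \<comment> \<open>This choice makes \<open>x / A\<close> less than one half, also for
    \<open>x = 0\<close>, so a geometric series dominates.\<close>
  define A where "A = 2 * x + 1"
  define c where "c = exp (- (A + 1)) / (2 + A)\<^sup>2"
  have A: "A > 0" using x by (simp add: A_def)
  then have c: "c > 0" by (simp add: c_def)
  show "summable (\<lambda>n. (x / A) ^ n / c)"
    using x by (intro summable_divide summable_geometric) (simp add: A_def)
  fix n
  have "x ^ n / HF_eta n \<le> x ^ n / (A ^ n * c)"
    using HF_eta_ge[of A n] A c x HF_eta_pos[of n]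
    by (intro divide_left_mono) (auto simp: c_def)
  then show "norm (x ^ n / HF_eta n) \<le> (x / A) ^ n / c"
    using x HF_eta_pos[of n] by (simp add: power_divide)
qed

lemma has_bochner_integral_norm_power:
  "has_bochner_integral HF_measure (\<lambda>z. cmod z ^ (2 * n)) (HF_eta n)"
proof (rule has_bochner_integral_nn_integral)
  have "(\<integral>\<^sup>+z. ennreal (cmod z ^ (2 * n)) \<partial>HF_measure) =
      (\<integral>\<^sup>+t. ennreal (exp (- t) / (1 + t)\<^sup>2) * ennreal (t ^ n) * indicator {0..} t \<partial>lborel)"
    using nn_integral_HF_measure_radial[of "\<lambda>t. ennreal (t ^ n)"] by (simp add: power_mult)
  also have "\<dots> = (\<integral>\<^sup>+t. ennreal (indicat_real {0..} t *\<^sub>R (t ^ n / (1 + t)\<^sup>2 * exp (- t))) \<partial>lborel)"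
    by (intro nn_integral_cong) (auto simp: ennreal_mult[symmetric] mult.commute split: split_indicator)
  also have "\<dots> = ennreal (HF_eta n)"
    unfolding HF_eta_def set_lebesgue_integral_def
    using set_integrable_HF_eta[of n]
    by (intro nn_integral_eq_integral) (auto simp: set_integrable_def split: split_indicator)
  finally show "(\<integral>\<^sup>+z. ennreal (cmod z ^ (2 * n)) \<partial>HF_measure) = ennreal (HF_eta n)" .
qed (use HF_eta_pos[of n] in auto)

text \<open>The total mass is the moment for \<open>n = 0\<close>. Finiteness makes constants
  admissible as dominating functions.\<close>

lemma finite_measure_HF_measure: "finite_measure HF_measure"
proof
  have "integrable HF_measure (\<lambda>z. 1 :: real)"
    using has_bochner_integral_norm_power[of 0] by (simp add: has_bochner_integral_iff)
  then show "emeasure HF_measure (space HF_measure) \<noteq> \<infinity>"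
    by (simp add: integrable_iff_bounded top.not_eq_extremum)
qed

section \<open>Orthogonality of the monomials\<close>

lemma distr_HF_measure_rotation:
  assumes "cmod c = 1"
  shows "distr HF_measure borel ((*) c) = HF_measure"
proof -
  have "HF_measure = density (distr lborel borel ((*) c))
      (\<lambda>z. ennreal (exp (- (cmod z)\<^sup>2) / (pi * (1 + (cmod z)\<^sup>2)\<^sup>2)))"
    using distr_lborel_rotation[OF assms] by (simp add: HF_measure_def)
  also have "\<dots> = distr HF_measure borel ((*) c)"
    unfolding HF_measure_def using assms by (subst density_distr) (auto simp: norm_mult)
  finally show ?thesis by simp
qed

text \<open>Rotating by \<open>\<pi> / (m - n)\<close> changes the sign of the integrand.\<close>

lemma integral_HF_measure_orthogonal:
  fixes h :: "real \<Rightarrow> complex"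
  assumes [measurable]: "h \<in> borel_measurable borel" and "m \<noteq> n"
  shows "(\<integral>z. h (cmod z) * (z ^ m * cnj z ^ n) \<partial>HF_measure) = 0"
proof -
  let ?F = "\<lambda>z. h (cmod z) * (z ^ m * cnj z ^ n)"
  define c where "c = cis (pi / (real m - real n))"
  have "c ^ m * cnj c ^ n = cis (real m * (pi / (real m - real n)) - real n * (pi / (real m - real n)))"
    by (simp add: c_def Complex.DeMoivre cis_cnj cis_mult diff_conv_add_uminus del: add_uminus_conv_diff)
  also have "\<dots> = cis pi"
    unfolding left_diff_distrib[symmetric] using \<open>m \<noteq> n\<close> by simp
  finally have c: "c ^ m * cnj c ^ n = -1" by simp
  have F: "?F (c * z) = - ?F z" for z
  proof -
    have "cmod (c * z) = cmod z" by (simp add: norm_mult c_def)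
    then have "?F (c * z) = (c ^ m * cnj c ^ n) * ?F z" by (simp add: power_mult_distrib)
    then show ?thesis by (simp add: c)
  qed
  have "(\<integral>z. ?F z \<partial>HF_measure) = (\<integral>z. ?F z \<partial>distr HF_measure borel ((*) c))"
    by (simp add: distr_HF_measure_rotation c_def)
  also have "\<dots> = (\<integral>z. ?F (c * z) \<partial>HF_measure)"
    by (rule integral_distr) measurable
  also have "\<dots> = - (\<integral>z. ?F z \<partial>HF_measure)" unfolding F by simp
  finally show ?thesis by simp
qed

lemma has_bochner_integral_monomials:
  "has_bochner_integral HF_measure (\<lambda>z. z ^ m * cnj z ^ n) (if m = n then of_real (HF_eta n) else 0)"
proof -
  have "integrable HF_measure (\<lambda>z. z ^ m * cnj (z ^ n))"
    using has_bochner_integral_norm_power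
    by (intro integrable_mult_cnj) (auto simp: norm_power has_bochner_integral_iff simp flip: power_mult power2_eq_square simp: mult.commute)
  moreover have "(\<integral>z. z ^ m * cnj z ^ n \<partial>HF_measure) = (if m = n then of_real (HF_eta n) else 0)"
  proof (cases "m = n")
    case True
    have "z ^ m * cnj z ^ n = of_real (cmod z ^ (2 * n))" for z
      unfolding power_mult of_real_power[of "(cmod z)\<^sup>2"] complex_norm_square
      by (simp add: True power_mult_distrib)
    then show ?thesis
      using True has_bochner_integral_norm_power[of n]
      by (simp only: has_bochner_integral_iff integral_complex_of_real if_True simp_thms)
  qed (use integral_HF_measure_orthogonal[of "\<lambda>_. 1" m n] in simp)
  ultimately show ?thesis by (simp add: has_bochner_integral_iff)
qed

text \<open>Pythagoras for the orthogonal monomials. The nonnegative integral is used because this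
  is the form in which Fatou's lemma takes it.\<close>

lemma nn_integral_polynomial:
  assumes A: "finite A"
  shows "(\<integral>\<^sup>+z. ennreal ((cmod (\<Sum>n\<in>A. b n * z ^ n))\<^sup>2) \<partial>HF_measure)
    = ennreal (\<Sum>n\<in>A. (cmod (b n))\<^sup>2 * HF_eta n)"
proof -
  have "has_bochner_integral HF_measure (\<lambda>z. \<Sum>n\<in>A. \<Sum>m\<in>A. b n * cnj (b m) * (z ^ n * cnj z ^ m))
      (\<Sum>n\<in>A. \<Sum>m\<in>A. b n * cnj (b m) * (if n = m then of_real (HF_eta m) else 0))"
    by (intro has_bochner_integral_sum has_bochner_integral_mult_right has_bochner_integral_monomials)
  also have "(\<lambda>z. \<Sum>n\<in>A. \<Sum>m\<in>A. b n * cnj (b m) * (z ^ n * cnj z ^ m))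
      = (\<lambda>z. of_real ((cmod (\<Sum>n\<in>A. b n * z ^ n))\<^sup>2))"
    by (rule ext) (simp only: complex_norm_square cnj_sum sum_product, simp add: mult_ac)
  also have "(\<Sum>n\<in>A. \<Sum>m\<in>A. b n * cnj (b m) * (if n = m then of_real (HF_eta m) else 0))
      = (\<Sum>n\<in>A. b n * cnj (b n) * of_real (HF_eta n))"
    using A by (intro sum.cong) (auto simp: if_distrib cong: if_cong)
  also have "\<dots> = of_real (\<Sum>n\<in>A. (cmod (b n))\<^sup>2 * HF_eta n)"
    by (simp add: complex_norm_square del: of_real_power)
  finally have "has_bochner_integral HF_measure (\<lambda>z. (cmod (\<Sum>n\<in>A. b n * z ^ n))\<^sup>2)
      (\<Sum>n\<in>A. (cmod (b n))\<^sup>2 * HF_eta n)"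
    by (simp only: has_bochner_integral_iff complex_of_real_integrable_eq integral_complex_of_real of_real_eq_iff)
  then show ?thesis
    by (simp add: has_bochner_integral_iff nn_integral_eq_integral)
qed

section \<open>The reproducing property\<close>

lemma (in function_inner_product_space) norm_ip_le:
  assumes f: "f \<in> H" and g: "g \<in> H"
  shows "cmod (ip f g) \<le> ip_norm f * ip_norm g"
proof (cases "ip f g = 0")
  case True
  then show ?thesis using f g by (simp add: ip_norm_nonneg)
next
  case False
  \<comment> \<open>The unimodular factor \<open>c\<close> turns the inner product into its modulus
    and leaves the norm of \<open>f\<close> unchanged, which reduces the claim to the bound on real
    parts.\<close>
  define c where "c = cnj (sgn (ip f g))"
  have c: "c * ip f g = of_real (cmod (ip f g))"
    using complex_norm_square[of "ip f g"] False
    by (simp add: c_def sgn_div_norm scaleR_conv_of_real field_simps power2_eq_square)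
  have "cmod c = 1" using False by (simp add: c_def norm_sgn)
  then have "c * cnj c = 1" by (simp flip: complex_norm_square)
  then have "ip (\<lambda>x. c * f x) (\<lambda>x. c * f x) = ip f f"
    using f by (simp add: ip_scale_left ip_scale_right scale_mem flip: mult.assoc)
  then have "ip_norm (\<lambda>x. c * f x) = ip_norm f" by (simp add: ip_norm_def)
  moreover have "Re (ip (\<lambda>x. c * f x) g) = cmod (ip f g)"
    using f g c by (simp add: ip_scale_left)
  ultimately show ?thesis using Re_ip_le[OF scale_mem[OF f, of c] g] by simp
qed

text \<open>The set where \<open>f\<close> does not vanish is open, and a nonempty open set is not
  negligible. This yields definiteness of the inner product.\<close>

lemma AE_lborel_continuous_imp_zero:
  fixes f :: "'a::euclidean_space \<Rightarrow> 'b::real_normed_vector"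
  assumes cont: "continuous_on UNIV f" and ae: "AE x in lborel. f x = 0"
  shows "f = (\<lambda>x. 0)"
proof -
  have "open (f -` (- {0}))"
    by (rule open_vimage[OF _ cont]) (rule open_Compl[OF closed_singleton])
  moreover have "f -` (- {0}) = {x. f x \<noteq> 0}" by auto
  ultimately have op: "open {x. f x \<noteq> 0}" by (simp only:)
  have "{x. f x \<noteq> 0} \<in> null_sets lborel"
    using ae op by (simp add: AE_iff_null_sets)
  then have "negligible {x. f x \<noteq> 0}"
    by (simp add: negligible_iff_null_sets null_sets_completionI)
  then show ?thesis using open_not_negligible[OF op] by auto
qed

lemma HF_space_borel: "f \<in> HF_space \<Longrightarrow> f \<in> borel_measurable borel"
  by (simp add: HF_space_iff borel_measurable_entire)

lemma HF_space_integrable: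
  "f \<in> HF_space \<Longrightarrow> g \<in> HF_space \<Longrightarrow> integrable HF_measure (\<lambda>z. f z * cnj (g z))"
  by (rule integrable_mult_cnj) (auto simp: HF_space_borel, auto simp: HF_space_iff)

lemma HF_inner_self_eq:
  assumes "f \<in> HF_space"
  shows "HF_inner f f = of_real (\<integral>z. (cmod (f z))\<^sup>2 \<partial>HF_measure)"
  using assms
  by (simp only: HF_inner_eq HF_space_borel complex_norm_square[symmetric] integral_complex_of_real)

interpretation HF: function_inner_product_space HF_space HF_inner
proof
  show "(\<lambda>x. 0) \<in> HF_space" by (simp add: HF_space_iff)
next
  fix f g assume fg: "f \<in> HF_space" "g \<in> HF_space"
  then show "(\<lambda>x. f x + g x) \<in> HF_space"
    using integrable_norm_square_add[of f HF_measure g]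
    by (auto simp: HF_space_iff borel_measurable_entire intro: holomorphic_intros)
  show "HF_inner g f = cnj (HF_inner f g)"
    using fg Bochner_Integration.integral_cnj[of HF_measure "\<lambda>z. f z * cnj (g z)"]
    by (simp add: HF_inner_eq HF_space_borel mult.commute)
  show "HF_inner (\<lambda>x. c * f x) g = c * HF_inner f g" for c
    using fg by (simp add: HF_inner_eq HF_space_borel borel_measurable_times mult.assoc)
  fix h assume h: "h \<in> HF_space"
  show "HF_inner (\<lambda>x. f x + g x) h = HF_inner f h + HF_inner g h"
    using fg h by (simp add: HF_inner_eq HF_space_borel borel_measurable_add distrib_right HF_space_integrable)
next
  fix f and c :: complex assume f: "f \<in> HF_space"
  then show "(\<lambda>x. c * f x) \<in> HF_space"
    by (auto simp: HF_space_iff norm_mult power_mult_distrib intro: holomorphic_intros)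
  show "0 \<le> Re (HF_inner f f)"
    using f by (simp add: HF_inner_self_eq)
  assume "HF_inner f f = 0"
  then have "(\<integral>z. (cmod (f z))\<^sup>2 \<partial>HF_measure) = 0"
    using f by (simp add: HF_inner_self_eq)
  then have "AE z in HF_measure. f z = 0"
    using f by (subst (asm) integral_nonneg_eq_0_iff_AE) (auto simp: HF_space_iff)
  \<comment> \<open>The density is strictly positive everywhere, so a null set of
    \<open>HF_measure\<close> is a null set of \<open>lborel\<close>.\<close>
  moreover have "0 < pi * (1 + (cmod z)\<^sup>2)\<^sup>2" for z
    by (intro mult_pos_pos zero_less_power add_pos_nonneg) auto
  ultimately have "AE z in lborel. f z = 0"
    unfolding HF_measure_def by (subst (asm) AE_density) auto
  moreover have "continuous_on UNIV f"
    using f by (simp add: HF_space_iff holomorphic_on_imp_continuous_on)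
  ultimately show "f = (\<lambda>x. 0)" by (intro AE_lborel_continuous_imp_zero)
qed

lemma HF_ip_norm_power2:
  assumes "f \<in> HF_space"
  shows "(\<integral>\<^sup>+z. ennreal ((cmod (f z))\<^sup>2) \<partial>HF_measure) = ennreal ((HF.ip_norm f)\<^sup>2)"
  using assms
  by (simp add: HF.ip_norm_power2 HF_inner_self_eq HF_space_iff nn_integral_eq_integral)

text \<open>Fatou's lemma carries a bound \<open>C\<close> on squared norms to the pointwise limit,
  and membership of the limit in the space comes as a result. It serves both for tails of the kernel
  series and for limits of Cauchy sequences.\<close>

lemma HF_spaceI_Fatou:
  assumes hol: "f holomorphic_on UNIV"
    and meas: "\<And>k. g k \<in> borel_measurable borel"
    and lim: "\<And>z. (\<lambda>k. g k z) \<longlonglongrightarrow> f z"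
    and le: "\<And>k. k \<ge> N \<Longrightarrow> (\<integral>\<^sup>+z. ennreal ((cmod (g k z))\<^sup>2) \<partial>HF_measure) \<le> ennreal C"
    and C: "0 \<le> C"
  shows "f \<in> HF_space" "HF.ip_norm f \<le> sqrt C"
proof -
  have [measurable]: "f \<in> borel_measurable borel" using hol by (rule borel_measurable_entire)
  note meas[measurable]
  have "(\<integral>\<^sup>+z. ennreal ((cmod (f z))\<^sup>2) \<partial>HF_measure)
      = (\<integral>\<^sup>+z. liminf (\<lambda>k. ennreal ((cmod (g k z))\<^sup>2)) \<partial>HF_measure)"
  proof (rule nn_integral_cong)
    fix z
    have "(\<lambda>k. ennreal ((cmod (g k z))\<^sup>2)) \<longlonglongrightarrow> ennreal ((cmod (f z))\<^sup>2)"
      by (intro tendsto_intros lim)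
    then show "ennreal ((cmod (f z))\<^sup>2) = liminf (\<lambda>k. ennreal ((cmod (g k z))\<^sup>2))"
      by (intro lim_imp_Liminf[symmetric]) auto
  qed
  also have "\<dots> \<le> liminf (\<lambda>k. \<integral>\<^sup>+z. ennreal ((cmod (g k z))\<^sup>2) \<partial>HF_measure)"
    by (rule nn_integral_liminf) measurable
  also have "\<dots> \<le> limsup (\<lambda>k. \<integral>\<^sup>+z. ennreal ((cmod (g k z))\<^sup>2) \<partial>HF_measure)"
    by (rule Liminf_le_Limsup) simp
  also have "\<dots> \<le> ennreal C"
    by (rule Limsup_bounded) (auto simp: eventually_sequentially intro!: le)
  finally have *: "(\<integral>\<^sup>+z. ennreal ((cmod (f z))\<^sup>2) \<partial>HF_measure) \<le> ennreal C" .
  also have "\<dots> < \<infinity>" by simp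
  finally show f: "f \<in> HF_space"
    using hol by (auto simp: HF_space_iff intro!: integrableI_bounded)
  have "(HF.ip_norm f)\<^sup>2 \<le> C"
    using * C unfolding HF_ip_norm_power2[OF f] by (simp add: ennreal_le_iff)
  then show "HF.ip_norm f \<le> sqrt C" by (rule real_le_rsqrt)
qed

section \<open>Taylor coefficients as inner products\<close>

lemma entire_sums:
  assumes "f holomorphic_on UNIV"
  shows "(\<lambda>n. (deriv ^^ n) f 0 / fact n * z ^ n) sums f z"
  using holomorphic_power_series[of f 0 "norm z + 1" z] assms
  by (auto intro: holomorphic_on_subset)

lemma holomorphic_on_UNIV_sums:
  assumes "\<And>z. (\<lambda>n. a n * z ^ n) sums f z"
  shows "f holomorphic_on UNIV"
  unfolding holomorphic_on_def
proof
  fix z :: complex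
  have "f holomorphic_on ball 0 (norm z + 1)"
    by (rule power_series_holomorphic) (use assms in auto)
  then show "f field_differentiable at z"
    by (rule holomorphic_on_imp_differentiable_at) auto
qed

lemma monomial_in_HF_space: "(\<lambda>z. z ^ n) \<in> HF_space"
  using has_bochner_integral_norm_power[of n]
  by (auto simp: HF_space_iff has_bochner_integral_iff norm_power mult.commute
      intro!: holomorphic_intros simp flip: power_mult)

text \<open>Dominated convergence with the modulus of \<open>G\<close> as majorant. It transfers
  identities proved on discs to the whole plane.\<close>

lemma integral_HF_measure_truncated:
  fixes G :: "complex \<Rightarrow> complex"
  assumes G: "integrable HF_measure G"
  shows "(\<lambda>m. \<integral>z. indicator {..real m} (cmod z) * G z \<partial>HF_measure) \<longlonglongrightarrow> (\<integral>z. G z \<partial>HF_measure)"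
proof (rule integral_dominated_convergence[where w="\<lambda>z. norm (G z)"])
  have [measurable]: "G \<in> borel_measurable borel"
    using borel_measurable_integrable[OF G] by simp
  show "G \<in> borel_measurable HF_measure"
    "(\<lambda>z. indicator {..real m} (cmod z) * G z) \<in> borel_measurable HF_measure" for m
    by measurable
  show "integrable HF_measure (\<lambda>z. norm (G z))" using G by simp
  show "AE z in HF_measure. norm (indicator {..real m} (cmod z) * G z) \<le> norm (G z)" for m
    by (auto simp: norm_mult split: split_indicator)
  show "AE z in HF_measure. (\<lambda>m. indicator {..real m} (cmod z) * G z) \<longlonglongrightarrow> G z"
  proof (rule AE_I2)
    fix z
    have "eventually (\<lambda>m. cmod z \<le> real m) sequentially"
      by (rule eventually_ge_at_top[THEN eventually_compose_filterlim]) (rule filterlim_real_sequentially)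
    then have "eventually (\<lambda>m. indicator {..real m} (cmod z) * G z = G z) sequentially"
      by eventually_elim simp
    then show "(\<lambda>m. indicator {..real m} (cmod z) * G z) \<longlonglongrightarrow> G z" by (rule tendsto_eventually)
  qed
qed

text \<open>On a disc the power series is dominated by a constant and may be integrated termwise; on the
  whole plane no dominating function is available yet.\<close>

lemma integral_truncated_coefficient:
  assumes a: "\<And>z. (\<lambda>n. a n * z ^ n) sums f z" and R: "R \<ge> 0"
  shows "(\<integral>z. indicator {..R} (cmod z) * (f z * cnj z ^ n) \<partial>HF_measure)
    = a n * (\<integral>z. indicator {..R} (cmod z) * (z ^ n * cnj z ^ n) \<partial>HF_measure)"
    (is "?L = a n * ?I")
proof (rule LIMSEQ_unique)
  let ?s = "\<lambda>N z. \<Sum>k<N. a k * (indicator {..R} (cmod z) * (z ^ k * cnj z ^ n))"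
  have [measurable]: "f \<in> borel_measurable borel"
    using holomorphic_on_UNIV_sums[OF a] by (rule borel_measurable_entire)
  \<comment> \<open>Absolute convergence at \<open>R\<close> follows from convergence at the
    strictly larger radius \<open>R + 1\<close>.\<close>
  have "summable (\<lambda>k. norm (a k * of_real R ^ k))"
    using R by (intro powser_insidea[of _ "of_real (R + 1)"] sums_summable[OF a]) simp
  then have sm: "summable (\<lambda>k. cmod (a k) * R ^ k)"
    using R by (simp add: norm_mult norm_power)
  show "(\<lambda>N. \<integral>z. ?s N z \<partial>HF_measure) \<longlonglongrightarrow> ?L"
  proof (rule integral_dominated_convergence[where w="\<lambda>z. (\<Sum>k. cmod (a k) * R ^ k) * R ^ n"])
    show "integrable HF_measure (\<lambda>z. (\<Sum>k. cmod (a k) * R ^ k) * R ^ n)"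
      using finite_measure.integrable_const[OF finite_measure_HF_measure] .
    show "AE z in HF_measure. (\<lambda>N. ?s N z) \<longlonglongrightarrow> indicator {..R} (cmod z) * (f z * cnj z ^ n)"
    proof (rule AE_I2)
      fix z
      have "(\<lambda>N. indicator {..R} (cmod z) * ((\<Sum>k<N. a k * z ^ k) * cnj z ^ n))
          \<longlonglongrightarrow> indicator {..R} (cmod z) * (f z * cnj z ^ n)"
        using a[of z] unfolding sums_def by (intro tendsto_intros)
      then show "(\<lambda>N. ?s N z) \<longlonglongrightarrow> indicator {..R} (cmod z) * (f z * cnj z ^ n)"
        by (simp add: sum_distrib_left sum_distrib_right mult_ac)
    qed
    show "AE z in HF_measure. norm (?s N z) \<le> (\<Sum>k. cmod (a k) * R ^ k) * R ^ n" for N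
    proof (rule AE_I2)
      fix z
      have "norm (?s N z) \<le> (\<Sum>k<N. norm (a k * (indicator {..R} (cmod z) * (z ^ k * cnj z ^ n))))"
        by (rule norm_sum)
      also have "\<dots> \<le> (\<Sum>k<N. cmod (a k) * R ^ k * R ^ n)"
      proof (rule sum_mono)
        fix k
        show "norm (a k * (indicator {..R} (cmod z) * (z ^ k * cnj z ^ n))) \<le> cmod (a k) * R ^ k * R ^ n"
        proof (cases "cmod z \<le> R")
          case True
          then show ?thesis
            using R by (auto simp: norm_mult norm_power mult.assoc intro!: mult_left_mono mult_mono power_mono)
        qed (use R in simp)
      qed
      also have "\<dots> \<le> (\<Sum>k. cmod (a k) * R ^ k) * R ^ n"
        unfolding sum_distrib_right[symmetric]
        using R by (intro mult_right_mono sum_le_suminf sm) auto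
      finally show "norm (?s N z) \<le> (\<Sum>k. cmod (a k) * R ^ k) * R ^ n" .
    qed
  qed measurable
  have int: "integrable HF_measure (\<lambda>z. indicator {..R} (cmod z) * (z ^ k * cnj z ^ n))" for k
  proof (rule Bochner_Integration.integrable_bound)
    show "integrable HF_measure (\<lambda>z. z ^ k * cnj z ^ n)"
      using has_bochner_integral_monomials[of k n] by (simp add: has_bochner_integral_iff)
  qed (auto split: split_indicator)
  \<comment> \<open>Orthogonality holds on the disc too, since the indicator is a radial factor.
    Hence once \<open>N\<close> exceeds \<open>n\<close>, only the term with index \<open>n\<close>
    survives.\<close>
  have "(\<integral>z. ?s N z \<partial>HF_measure) = a n * ?I" if "N \<ge> Suc n" for N
  proof -
    have "(\<integral>z. ?s N z \<partial>HF_measure)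
        = (\<Sum>k<N. a k * (\<integral>z. indicator {..R} (cmod z) * (z ^ k * cnj z ^ n) \<partial>HF_measure))"
      using int by (subst Bochner_Integration.integral_sum) auto
    also have "\<dots> = (\<Sum>k<N. if k = n then a n * ?I else 0)"
      by (intro sum.cong) (auto simp: integral_HF_measure_orthogonal)
    finally show ?thesis using that by simp
  qed
  then show "(\<lambda>N. \<integral>z. ?s N z \<partial>HF_measure) \<longlonglongrightarrow> a n * ?I"
    by (intro tendsto_eventually) (auto simp: eventually_sequentially)
qed

text \<open>On each disc the integral is \<open>a n\<close> times the truncated moment. Letting the
  radius tend to infinity, the left side converges because the product of \<open>f\<close> with the
  conjugate monomial is integrable, and the truncated moment tends to
  \<open>HF_eta n\<close>.\<close>

lemma HF_inner_monomial:
  assumes f: "f \<in> HF_space" and a: "\<And>z. (\<lambda>n. a n * z ^ n) sums f z"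
  shows "HF_inner f (\<lambda>z. z ^ n) = a n * of_real (HF_eta n)"
proof -
  have "integrable HF_measure (\<lambda>z. f z * cnj z ^ n)"
    using HF_space_integrable[OF f monomial_in_HF_space[of n]] by simp
  from integral_HF_measure_truncated[OF this]
  have "(\<lambda>m. a n * (\<integral>z. indicator {..real m} (cmod z) * (z ^ n * cnj z ^ n) \<partial>HF_measure))
      \<longlonglongrightarrow> (\<integral>z. f z * cnj z ^ n \<partial>HF_measure)"
    by (simp add: integral_truncated_coefficient[OF a])
  moreover have "(\<lambda>m. a n * (\<integral>z. indicator {..real m} (cmod z) * (z ^ n * cnj z ^ n) \<partial>HF_measure))
      \<longlonglongrightarrow> a n * of_real (HF_eta n)"
    using has_bochner_integral_monomials[of n n] integral_HF_measure_truncated[of "\<lambda>z. z ^ n * cnj z ^ n"]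
    by (intro tendsto_mult_left) (auto simp: has_bochner_integral_iff)
  ultimately have "(\<integral>z. f z * cnj z ^ n \<partial>HF_measure) = a n * of_real (HF_eta n)"
    by (rule LIMSEQ_unique)
  then show ?thesis using f by (simp add: HF_inner_eq HF_space_borel)
qed

section \<open>The kernel series and the reproduction of values\<close>

lemma HF_kernel_sums:
  "(\<lambda>n. z ^ n * cnj w ^ n / of_real (HF_eta n)) sums HF_kernel z w"
proof -
  have "norm (z ^ n * cnj w ^ n / of_real (HF_eta n)) = (cmod z * cmod w) ^ n / HF_eta n" for n
    using HF_eta_pos[of n] by (simp add: norm_mult norm_divide norm_power power_mult_distrib)
  then have "summable (\<lambda>n. norm (z ^ n * cnj w ^ n / of_real (HF_eta n)))"
    using summable_HF_eta[of "cmod z * cmod w"] by simp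
  then show ?thesis
    unfolding HF_kernel_def by (rule summable_sums[OF summable_norm_cancel])
qed

lemma HF_kernel_sums': "(\<lambda>n. cnj w ^ n / of_real (HF_eta n) * z ^ n) sums HF_kernel z w"
  using HF_kernel_sums[of z w] by (simp add: mult.commute)

text \<open>The number \<open>t n\<close> is the squared norm of the term of index \<open>n\<close>,
  so by Pythagoras a block from \<open>N\<close> to \<open>M\<close> has squared norm at most the
  tail of the series of \<open>t\<close>. Fatou's lemma lets \<open>M\<close> tend to infinity. The
  case \<open>N = 0\<close> gives membership and a norm bound for the kernel itself, and growing
  \<open>N\<close> gives convergence in norm.\<close>

lemma HF_kernel_tail:
  fixes w :: complex and N :: nat
  defines "t \<equiv> \<lambda>n. ((cmod w)\<^sup>2) ^ n / HF_eta n"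
  defines "r \<equiv> \<lambda>z. HF_kernel z w - (\<Sum>n<N. cnj w ^ n / of_real (HF_eta n) * z ^ n)"
  shows "r \<in> HF_space" "HF.ip_norm r \<le> sqrt (suminf t - (\<Sum>n<N. t n))"
proof -
  define g where "g M z = (\<Sum>n\<in>{N..<M}. cnj w ^ n / of_real (HF_eta n) * z ^ n)" for M z
  have t: "summable t" unfolding t_def by (rule summable_HF_eta) simp
  have t0: "t n \<ge> 0" for n using HF_eta_pos[of n] by (simp add: t_def)
  have hol: "r holomorphic_on UNIV"
    unfolding r_def using holomorphic_on_UNIV_sums[OF HF_kernel_sums'[of w]]
    by (intro holomorphic_intros)
  have meas: "g M \<in> borel_measurable borel" for M
    unfolding g_def by measurable
  have lim: "(\<lambda>M. g M z) \<longlonglongrightarrow> r z" for z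
  proof (rule Lim_transform_eventually)
    show "(\<lambda>M. (\<Sum>n<M. cnj w ^ n / of_real (HF_eta n) * z ^ n)
        - (\<Sum>n<N. cnj w ^ n / of_real (HF_eta n) * z ^ n)) \<longlonglongrightarrow> r z"
      using HF_kernel_sums'[of w z] unfolding r_def sums_def by (intro tendsto_intros)
    show "\<forall>\<^sub>F M in sequentially. (\<Sum>n<M. cnj w ^ n / of_real (HF_eta n) * z ^ n)
        - (\<Sum>n<N. cnj w ^ n / of_real (HF_eta n) * z ^ n) = g M z"
      using eventually_ge_at_top[of N]
    proof eventually_elim
      case (elim M)
      then show ?case
        unfolding g_def lessThan_atLeast0 by (intro sum_diff_nat_ivl) auto
    qed
  qed
  have le: "(\<integral>\<^sup>+z. ennreal ((cmod (g M z))\<^sup>2) \<partial>HF_measure) \<le> ennreal (suminf t - (\<Sum>n<N. t n))"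
    if "M \<ge> N" for M
  proof -
    have "(\<integral>\<^sup>+z. ennreal ((cmod (g M z))\<^sup>2) \<partial>HF_measure)
        = ennreal (\<Sum>n\<in>{N..<M}. (cmod (cnj w ^ n / of_real (HF_eta n)))\<^sup>2 * HF_eta n)"
      unfolding g_def by (rule nn_integral_polynomial) simp
    also have "(\<Sum>n\<in>{N..<M}. (cmod (cnj w ^ n / of_real (HF_eta n)))\<^sup>2 * HF_eta n) = sum t {N..<M}"
    proof (rule sum.cong)
      fix n
      show "(cmod (cnj w ^ n / of_real (HF_eta n)))\<^sup>2 * HF_eta n = t n"
        using HF_eta_pos[of n]
        by (simp add: t_def norm_divide norm_power power_divide power2_eq_square power_mult_distrib)
    qed simp
    also have "sum t {N..<M} = (\<Sum>n<M. t n) - (\<Sum>n<N. t n)"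
      using that unfolding lessThan_atLeast0 by (intro sum_diff_nat_ivl[symmetric]) auto
    also have "\<dots> \<le> suminf t - (\<Sum>n<N. t n)"
      using t t0 by (simp add: sum_le_suminf)
    finally show ?thesis by (simp add: ennreal_leI)
  qed
  have "0 \<le> suminf t - (\<Sum>n<N. t n)" using t t0 by (simp add: sum_le_suminf)
  from HF_spaceI_Fatou[OF hol meas lim le this]
  show "r \<in> HF_space" "HF.ip_norm r \<le> sqrt (suminf t - (\<Sum>n<N. t n))" by blast+
qed

lemma HF_kernel_mem: "(\<lambda>z. HF_kernel z w) \<in> HF_space"
  using HF_kernel_tail(1)[of w 0] by simp

lemma polynomial_in_HF_space: "(\<lambda>z. \<Sum>n<N. b n * z ^ n) \<in> HF_space"
proof (induction N)
  case (Suc N)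
  then show ?case
    using HF.add_mem[OF Suc HF.scale_mem[OF monomial_in_HF_space[of N], of "b N"]] by simp
qed (simp add: HF.zero_mem)

lemma HF_inner_polynomial:
  assumes f: "f \<in> HF_space"
  shows "HF_inner f (\<lambda>z. \<Sum>n<N. b n * z ^ n) = (\<Sum>n<N. cnj (b n) * HF_inner f (\<lambda>z. z ^ n))"
proof (induction N)
  case 0
  show ?case using HF.ip_scale_right[OF f HF.zero_mem, of 0] by simp
next
  case (Suc N)
  then show ?case
    using f by (simp add: HF.ip_add_right polynomial_in_HF_space HF.scale_mem monomial_in_HF_space HF.ip_scale_right)
qed

text \<open>Both sides are limits of the inner products of \<open>f\<close> with the partial sums
  \<open>p N\<close> of the kernel.\<close>

lemma HF_reproducing:
  assumes f: "f \<in> HF_space"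
  shows "f w = HF_inner f (\<lambda>z. HF_kernel z w)"
proof (rule LIMSEQ_unique)
  define a where "a n = (deriv ^^ n) f 0 / fact n" for n
  define t where "t n = ((cmod w)\<^sup>2) ^ n / HF_eta n" for n
  define p where "p N z = (\<Sum>n<N. cnj w ^ n / of_real (HF_eta n) * z ^ n)" for N z
  have a: "(\<lambda>n. a n * z ^ n) sums f z" for z
    using f entire_sums[of f z] by (simp add: a_def HF_space_iff)
  \<comment> \<open>The moment in \<open>HF_inner_monomial\<close> cancels the one in the kernel
    coefficient, and conjugation turns \<open>cnj w\<close> into \<open>w\<close>: a Taylor partial
    sum of \<open>f\<close> at \<open>w\<close> remains.\<close>
  have "HF_inner f (p N) = (\<Sum>n<N. a n * w ^ n)" for N
    unfolding p_def HF_inner_polynomial[OF f] HF_inner_monomial[OF f a]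
    by (intro sum.cong) (use HF_eta_pos in \<open>auto simp: less_imp_neq[symmetric]\<close>)
  then show "(\<lambda>N. HF_inner f (p N)) \<longlonglongrightarrow> f w"
    using a[of w] by (simp add: sums_def)
  show "(\<lambda>N. HF_inner f (p N)) \<longlonglongrightarrow> HF_inner f (\<lambda>z. HF_kernel z w)"
  proof (rule Lim_transform2)
    show "(\<lambda>N. HF_inner f (\<lambda>z. HF_kernel z w)) \<longlonglongrightarrow> HF_inner f (\<lambda>z. HF_kernel z w)" by simp
    have "summable t" unfolding t_def by (rule summable_HF_eta) simp
    then have "(\<lambda>N. HF.ip_norm f * sqrt (suminf t - (\<Sum>n<N. t n)))
        \<longlonglongrightarrow> HF.ip_norm f * sqrt (suminf t - suminf t)"
      by (intro tendsto_intros summable_LIMSEQ)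
    then have lim0: "(\<lambda>N. HF.ip_norm f * sqrt (suminf t - (\<Sum>n<N. t n))) \<longlonglongrightarrow> 0"
      by simp
    \<comment> \<open>Cauchy-Schwarz against the tail of the kernel, whose norm tends to 0.\<close>
    have "cmod (HF_inner f (\<lambda>z. HF_kernel z w) - HF_inner f (p N))
        \<le> HF.ip_norm f * sqrt (suminf t - (\<Sum>n<N. t n))" for N
    proof -
      let ?r = "\<lambda>z. HF_kernel z w - p N z"
      have r: "?r \<in> HF_space" "HF.ip_norm ?r \<le> sqrt (suminf t - (\<Sum>n<N. t n))"
        using HF_kernel_tail[of w N] by (simp_all add: t_def[abs_def] p_def)
      have p: "p N \<in> HF_space" unfolding p_def by (rule polynomial_in_HF_space)
      have "HF_inner f (\<lambda>z. HF_kernel z w) = HF_inner f ?r + HF_inner f (p N)"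
        using HF.ip_add_right[OF r(1) p f] by simp
      then show ?thesis
        using HF.norm_ip_le[OF f r(1)] mult_left_mono[OF r(2) HF.ip_norm_nonneg[OF f]] by simp
    qed
    then show "(\<lambda>N. HF_inner f (\<lambda>z. HF_kernel z w) - HF_inner f (p N)) \<longlonglongrightarrow> 0"
      by (intro Lim_null_comparison[OF _ lim0] always_eventually allI)
  qed
qed

section \<open>Completeness\<close>

text \<open>Cauchy-Schwarz applied to the reproducing identity. The bound on the norm of the kernel
  function increases with the modulus of \<open>w\<close>, so one constant serves the whole disc of
  radius \<open>R\<close>.\<close>

lemma HF_eval_le:
  assumes f: "f \<in> HF_space" and w: "cmod w \<le> R"
  shows "cmod (f w) \<le> HF.ip_norm f * sqrt (\<Sum>n. (R\<^sup>2) ^ n / HF_eta n)"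
proof -
  have "HF.ip_norm (\<lambda>z. HF_kernel z w) \<le> sqrt (\<Sum>n. ((cmod w)\<^sup>2) ^ n / HF_eta n)"
    using HF_kernel_tail(2)[of w 0] by simp
  also have "\<dots> \<le> sqrt (\<Sum>n. (R\<^sup>2) ^ n / HF_eta n)"
    using w HF_eta_pos
    by (intro real_sqrt_le_mono suminf_le summable_HF_eta divide_right_mono power_mono)
      (auto simp: less_imp_le)
  finally have "HF.ip_norm f * HF.ip_norm (\<lambda>z. HF_kernel z w)
      \<le> HF.ip_norm f * sqrt (\<Sum>n. (R\<^sup>2) ^ n / HF_eta n)"
    using HF.ip_norm_nonneg[OF f] by (rule mult_left_mono)
  then show ?thesis
    using HF.norm_ip_le[OF f HF_kernel_mem[of w]] HF_reproducing[OF f, of w] by simp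
qed

text \<open>Norm control gives uniform control on discs, so the pointwise limit is entire. Fatou's
  lemma then upgrades pointwise convergence to norm convergence.\<close>

lemma HF_mcomplete: "Metric_space.mcomplete HF_space (restrict_dist HF_space HF.ip_dist)"
proof -
  interpret M: Metric_space HF_space "restrict_dist HF_space HF.ip_dist"
    by (rule HF.Metric_space_ip)
  show ?thesis
    unfolding M.mcomplete_def
  proof (intro allI impI)
    fix g assume *: "M.MCauchy g"
    have "range g \<subseteq> HF_space"
      using * unfolding M.MCauchy_def by (rule conjunct1)
    then have g: "g n \<in> HF_space" for n by (rule range_subsetD)
    have cauchy: "\<exists>N. \<forall>m\<ge>N. \<forall>n\<ge>N. HF.ip_norm (\<lambda>z. g m z - g n z) < e" if "e > 0" for e
    proof -
      have "\<forall>e>0. \<exists>N. \<forall>m n. N \<le> m \<longrightarrow> N \<le> n \<longrightarrow> restrict_dist HF_space HF.ip_dist (g m) (g n) < e"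
        using * unfolding M.MCauchy_def by (rule conjunct2)
      from this[rule_format, OF that]
      obtain N where N: "\<forall>m n. N \<le> m \<longrightarrow> N \<le> n \<longrightarrow> restrict_dist HF_space HF.ip_dist (g m) (g n) < e" ..
      show ?thesis
      proof (intro exI allI impI)
        fix m n assume "m \<ge> N" "n \<ge> N"
        then show "HF.ip_norm (\<lambda>z. g m z - g n z) < e"
          using N g by (simp add: restrict_dist_def HF.ip_dist_def)
      qed
    qed
    define f where "f z = lim (\<lambda>n. g n z)" for z
    have unif: "uniform_limit (cball 0 R) g f sequentially" for R
    proof -
      have "uniformly_Cauchy_on (cball 0 R) g"
      proof (rule uniformly_Cauchy_onI)
        fix e :: real assume e: "e > 0"
        define C where "C = sqrt (\<Sum>n. (R\<^sup>2) ^ n / HF_eta n)"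
        have C: "C \<ge> 0"
          unfolding C_def using HF_eta_pos
          by (intro real_sqrt_ge_zero suminf_nonneg summable_HF_eta) (auto simp: less_imp_le)
        \<comment> \<open>Dividing by \<open>C + 1\<close> instead of \<open>C\<close> avoids a zero
          denominator and leaves the final inequality strict.\<close>
        obtain N where N: "\<And>m n. m \<ge> N \<Longrightarrow> n \<ge> N \<Longrightarrow> HF.ip_norm (\<lambda>z. g m z - g n z) < e / (C + 1)"
          using cauchy[of "e / (C + 1)"] e C by auto
        have "dist (g m z) (g n z) < e" if "z \<in> cball 0 R" "m \<ge> N" "n \<ge> N" for z m n
        proof -
          have "cmod (g m z - g n z) \<le> HF.ip_norm (\<lambda>z. g m z - g n z) * C"
            unfolding C_def by (rule HF_eval_le[OF HF.diff_mem[OF g g]]) (use that in simp)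
          also have "\<dots> \<le> e / (C + 1) * C"
            using N[OF that(2,3)] C by (intro mult_right_mono) auto
          also have "\<dots> < e" using e C by (simp add: field_simps)
          finally show ?thesis by (simp add: dist_norm)
        qed
        then show "\<exists>M. \<forall>z\<in>cball 0 R. \<forall>m\<ge>M. \<forall>n\<ge>M. dist (g m z) (g n z) < e" by blast
      qed
      then have "uniformly_convergent_on (cball 0 R) g" by (rule Cauchy_uniformly_convergent)
      then show ?thesis
        unfolding uniformly_convergent_uniform_limit_iff f_def .
    qed
    have lim: "(\<lambda>n. g n z) \<longlonglongrightarrow> f z" for z
      by (rule tendsto_uniform_limitI[OF unif[of "cmod z"]]) simp
    have hol: "f holomorphic_on UNIV"
    proof (rule holomorphic_uniform_sequence)
      show "g n holomorphic_on UNIV" for n using g[of n] by (simp add: HF_space_iff)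
      fix z :: complex
      have "cball z 1 \<subseteq> cball 0 (cmod z + 1)" 
      proof
        fix y assume "y \<in> cball z 1"
        then show "y \<in> cball 0 (cmod z + 1)"
          using norm_triangle_sub[of y z] by (simp add: dist_norm norm_minus_commute)
      qed
      then have "uniform_limit (cball z 1) g f sequentially"
        using unif uniform_limit_on_subset by blast
      then show "\<exists>d>0. cball z d \<subseteq> UNIV \<and> uniform_limit (cball z d) g f sequentially"
        by (intro exI[of _ 1]) simp
    qed simp
    have tail: "\<exists>N. \<forall>k\<ge>N. (\<lambda>z. g k z - f z) \<in> HF_space \<and> HF.ip_norm (\<lambda>z. g k z - f z) < e"
      if e: "e > 0" for e
    proof -
      \<comment> \<open>Passing to the limit weakens the strict bound to \<open>\<le>\<close>;
        halving \<open>e\<close> makes it strict again.\<close>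
      obtain N where N: "\<And>m n. m \<ge> N \<Longrightarrow> n \<ge> N \<Longrightarrow> HF.ip_norm (\<lambda>z. g m z - g n z) < e / 2"
        using cauchy[of "e / 2"] e by auto
      have "(\<lambda>z. g k z - f z) \<in> HF_space \<and> HF.ip_norm (\<lambda>z. g k z - f z) < e" if k: "k \<ge> N" for k
      proof -
        have d: "(\<lambda>z. g k z - g m z) \<in> HF_space" for m by (rule HF.diff_mem[OF g g])
        have hol': "(\<lambda>z. g k z - f z) holomorphic_on UNIV"
          using hol g[of k] by (intro holomorphic_intros) (simp_all add: HF_space_iff)
        have lim': "(\<lambda>m. g k z - g m z) \<longlonglongrightarrow> g k z - f z" for z
          by (intro tendsto_intros lim)
        have "(\<integral>\<^sup>+z. ennreal ((cmod (g k z - g m z))\<^sup>2) \<partial>HF_measure) \<le> ennreal ((e / 2)\<^sup>2)"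
          if "m \<ge> N" for m
          unfolding HF_ip_norm_power2[OF d]
          using N[OF k that] HF.ip_norm_nonneg[OF d] by (intro ennreal_leI power_mono) auto
        \<comment> \<open>Here \<open>k\<close> stays fixed while \<open>m\<close> tends to
          infinity.\<close>
        from HF_spaceI_Fatou[OF hol' HF_space_borel[OF d] lim' this]
        have "(\<lambda>z. g k z - f z) \<in> HF_space" "HF.ip_norm (\<lambda>z. g k z - f z) \<le> sqrt ((e / 2)\<^sup>2)"
          by simp_all
        then show ?thesis using e by simp
      qed
      then show ?thesis by blast
    qed
    obtain k where "(\<lambda>z. g k z - f z) \<in> HF_space" using tail[of 1] by auto
    \<comment> \<open>The limit is \<open>g k\<close> minus the difference of \<open>g k\<close> and
      \<open>f\<close>, both already in the space.\<close>
    from HF.diff_mem[OF g[of k] this] have f: "f \<in> HF_space" by simp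
    have "\<exists>N. \<forall>k\<ge>N. HF.ip_norm (\<lambda>z. g k z - f z) < e" if "e > 0" for e
      using tail[OF that] by metis
    then have "limitin M.mtopology g f sequentially"
      unfolding M.limit_metric_sequentially
      using f g by (simp add: restrict_dist_def HF.ip_dist_def)
    then show "\<exists>x. limitin M.mtopology g x sequentially" by (rule exI[of _ f])
  qed
qed

theorem theorem3p23:
  shows "reproducing_kernel_hilbert_space HF_space HF_inner
    \<and> is_reproducing_kernel HF_space HF_inner HF_kernel
    \<and> (\<forall>z w. (\<lambda>n. z ^ n * cnj w ^ n / of_real (HF_eta n)) sums HF_kernel z w
              \<and> HF_kernel z w = HF_E (z * cnj w))
    \<and> (\<forall>z. complex_of_real ((HF_norm (\<lambda>u. HF_kernel u z))\<^sup>2) = HF_kernel z z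
            \<and> HF_kernel z z = HF_E (of_real ((cmod z)\<^sup>2)))"
proof (intro conjI allI)
  show "reproducing_kernel_hilbert_space HF_space HF_inner"
  proof
    show "Metric_space.mcomplete HF_space (restrict_dist HF_space HF.ip_dist)"
      by (rule HF_mcomplete)
    show "\<exists>C. \<forall>f\<in>HF_space. cmod (f w) \<le> C * HF.ip_norm f" for w
    proof (intro exI ballI)
      fix f assume "f \<in> HF_space"
      from HF_eval_le[OF this order_refl]
      show "cmod (f w) \<le> sqrt (\<Sum>n. ((cmod w)\<^sup>2) ^ n / HF_eta n) * HF.ip_norm f"
        by (subst mult.commute)
    qed
  qed
  show "is_reproducing_kernel HF_space HF_inner HF_kernel"
    unfolding is_reproducing_kernel_def using HF_kernel_mem HF_reproducing by blast
  show "(\<lambda>n. z ^ n * cnj w ^ n / of_real (HF_eta n)) sums HF_kernel z w" for z w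
    by (rule HF_kernel_sums)
  show E: "HF_kernel z w = HF_E (z * cnj w)" for z w
    by (simp add: HF_kernel_def HF_E_def power_mult_distrib)
  show "complex_of_real ((HF_norm (\<lambda>u. HF_kernel u z))\<^sup>2) = HF_kernel z z" for z
    \<comment> \<open>The reproducing property is applied to the kernel function at \<open>z\<close>
      itself, evaluated at \<open>z\<close>.\<close>
    using HF_reproducing[OF HF_kernel_mem[of z], of z] by (simp only: HF_inner_self)
  show "HF_kernel z z = HF_E (of_real ((cmod z)\<^sup>2))" for z
    unfolding E complex_norm_square ..
qed

end
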